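(* Let $\mathcal{H}$ be a nonzero complex Hilbert space and let $S$ be a bilateral operator valued weighted shift on $\mathcal{H}$ with operator weights $\{S_n\}_{n\in\mathbb{Z}}$ such that $S_n$ is quasi-invertible for all $n\in\mathbb{Z}$. Then $S$ is unitarily equivalent to a bilateral operator valued weighted shift $T$ on $\mathcal{H}$ with operator weights $\{T_n\}_{n\in\mathbb{Z}}$ such that each $T_n$ is a positive operator.
   Context: $\boldsymbol{B}(\mathcal{K})$ is the algebra of bounded linear operators on a Hilbert space $\mathcal{K}$. An operator $A\in\boldsymbol{B}(\mathcal{H})$ is quasi-invertible if it is injective and has dense range; it is positive if $\langle Ax,x\rangle\ge 0$ for all $x\in\mathcal{H}$. $\ell_2(\mathbb{Z},\mathcal{H})=\bigoplus_{n\in\mathbb{Z}}\mathcal{H}$ is the Hilbert space of two-sided sequences $x=(x_n)_{n\in\mathbb{Z}}$ in $\mathcal{H}$ with $\sum_{n}\|x_n\|^2<\infty$. Bilateral operator valued weighted shift: given a two-sided sequence $\{S_n\}_{n\in\mathbb{Z}}\subseteq\boldsymbol{B}(\mathcal{H})$ of nonzero operators with $\{\|S_n\|\}_{n\in\mathbb{Z}}$ bounded, it is the operator $S\in\boldsymbol{B}(\ell_2(\mathbb{Z},\mathcal{H}))$ defined by $(Sx)_n=S_n x_{n-1}$, $n\in\mathbb{Z}$; the $S_n$ are its weights. Operators $S,T\in \boldsymbol{B}(\ell_2(\mathbb{Z},\mathcal{H}))$ are unitarily equivalent if $US=TU$ for some unitary $U\in \boldsymbol{B}(\ell_2(\mathbb{Z},\mathcal{H}))$.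 *)

theory Defs
  imports "HOL-Analysis.Analysis"
begin
text \<open>
  A complex inner product space is presented on top of its underlying real inner product
  space, whose inner product is \<open>Re \<langle>x, y\<rangle>\<close>; norm and topology are thereby the
  usual ones. The complex inner product is linear in its first argument.
\<close>

class complex_inner = real_inner +
  fixes scaleC :: "complex \<Rightarrow> 'a \<Rightarrow> 'a"  (infixr \<open>*\<^sub>C\<close> 75)
    and cinner :: "'a \<Rightarrow> 'a \<Rightarrow> complex"
  assumes scaleC_add_right: "c *\<^sub>C (x + y) = c *\<^sub>C x + c *\<^sub>C y"
    and scaleC_add_left: "(c + d) *\<^sub>C x = c *\<^sub>C x + d *\<^sub>C x"
    and scaleC_scaleC: "c *\<^sub>C d *\<^sub>C x = (c * d) *\<^sub>C x"
    and scaleC_of_real: "complex_of_real r *\<^sub>C x = r *\<^sub>R x"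
    and cinner_commute: "cinner x y = cnj (cinner y x)"
    and cinner_add_left: "cinner (x + y) z = cinner x z + cinner y z"
    and cinner_scaleC_left: "cinner (c *\<^sub>C x) y = c * cinner x y"
    and inner_eq_Re_cinner: "inner x y = Re (cinner x y)"

class chilbert_space = complex_inner + complete_space

lemma cinner_self: "cinner x x = complex_of_real ((norm x)\<^sup>2)" for x :: "'a::complex_inner"
proof -
  have "Im (cinner x x) = 0"
    using arg_cong[OF cinner_commute[of x x], of Im] by simp
  then show ?thesis
    by (simp add: complex_eq_iff inner_eq_Re_cinner[symmetric] power2_norm_eq_inner)
qed

lemma norm_scaleC: "norm (c *\<^sub>C x) = cmod c * norm x" for x :: "'a::complex_inner"
proof -
  have "cinner (c *\<^sub>C x) (c *\<^sub>C x) = c * cnj c * cinner x x"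
    by (metis cinner_commute cinner_scaleC_left complex_cnj_mult mult.assoc)
  also have "\<dots> = complex_of_real ((cmod c * norm x)\<^sup>2)"
    by (simp add: cinner_self complex_norm_square[symmetric] power_mult_distrib)
  finally have "complex_of_real ((norm (c *\<^sub>C x))\<^sup>2) = complex_of_real ((cmod c * norm x)\<^sup>2)"
    by (simp only: cinner_self)
  then have "(norm (c *\<^sub>C x))\<^sup>2 = (cmod c * norm x)\<^sup>2"
    by (simp only: of_real_eq_iff)
  then show ?thesis
    by (rule power2_eq_imp_eq) simp_all
qed

lemma cmod_cinner_le: "cmod (cinner x y) \<le> norm x * norm y" for x y :: "'a::complex_inner"
proof (cases "cinner x y = 0")
  case False
  define c where "c = cnj (cinner x y) / cmod (cinner x y)"
  have c: "cmod c = 1"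
    using False by (simp add: c_def norm_divide)
  have "cinner (c *\<^sub>C x) y = complex_of_real (cmod (cinner x y))"
    using False complex_norm_square[of "cinner x y"]
    by (simp add: cinner_scaleC_left c_def field_simps power2_eq_square)
  then have "cmod (cinner x y) = inner (c *\<^sub>C x) y"
    by (simp add: inner_eq_Re_cinner)
  also have "\<dots> \<le> norm (c *\<^sub>C x) * norm y"
    by (rule norm_cauchy_schwarz)
  finally show ?thesis
    by (simp add: norm_scaleC c)
qed simp

definition bounded_clinear :: "('a::complex_inner \<Rightarrow> 'b::complex_inner) \<Rightarrow> bool" where
  "bounded_clinear A \<longleftrightarrow> bounded_linear A \<and> (\<forall>c x. A (c *\<^sub>C x) = c *\<^sub>C A x)"

definition quasi_invertible :: "('a::complex_inner \<Rightarrow> 'a) \<Rightarrow> bool" where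
  "quasi_invertible A \<longleftrightarrow> bounded_clinear A \<and> inj A \<and> closure (range A) = UNIV"

definition positive_op :: "('a::complex_inner \<Rightarrow> 'a) \<Rightarrow> bool" where
  "positive_op A \<longleftrightarrow> bounded_clinear A \<and> (\<forall>x. cinner (A x) x \<in> \<real>\<^sub>\<ge>\<^sub>0)"

definition adjoint_pair :: "('a::complex_inner \<Rightarrow> 'b::complex_inner) \<Rightarrow> ('b \<Rightarrow> 'a) \<Rightarrow> bool" where
  "adjoint_pair A B \<longleftrightarrow> (\<forall>x y. cinner (A x) y = cinner x (B y))"

text \<open>\<open>U\<^sup>* U = I\<close> and \<open>U U\<^sup>* = I\<close>, where \<open>V\<close> is the (unique) adjoint \<open>U\<^sup>*\<close>.\<close>

definition unitary_op :: "('a::complex_inner \<Rightarrow> 'a) \<Rightarrow> bool" where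
  "unitary_op U \<longleftrightarrow> bounded_clinear U \<and>
     (\<exists>V. bounded_clinear V \<and> adjoint_pair U V \<and> V \<circ> U = id \<and> U \<circ> V = id)"

definition unitarily_equivalent ::
    "('a::complex_inner \<Rightarrow> 'a) \<Rightarrow> ('a \<Rightarrow> 'a) \<Rightarrow> bool" where
  "unitarily_equivalent S T \<longleftrightarrow> (\<exists>U. unitary_op U \<and> U \<circ> S = T \<circ> U)"

typedef (overloaded) 'a ell2Z =
    "{x :: int \<Rightarrow> 'a::complex_inner. (\<lambda>n. (norm (x n))\<^sup>2) summable_on UNIV}"
  morphisms nth_ell2Z Abs_ell2Z
  by (rule exI[of _ "\<lambda>_. 0"]) simp

lemma nth_ell2Z_summable: "(\<lambda>n. (norm (nth_ell2Z x n))\<^sup>2) summable_on UNIV"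
  using nth_ell2Z[of x] by simp

lemma ell2Z_eqI: "(\<And>n. nth_ell2Z x n = nth_ell2Z y n) \<Longrightarrow> x = y"
  by (simp add: nth_ell2Z_inject[symmetric] ext)

lemma square_summable_add:
  fixes x y :: "int \<Rightarrow> 'a::complex_inner"
  assumes "(\<lambda>n. (norm (x n))\<^sup>2) summable_on UNIV" "(\<lambda>n. (norm (y n))\<^sup>2) summable_on UNIV"
  shows "(\<lambda>n. (norm (x n + y n))\<^sup>2) summable_on UNIV"
proof (rule summable_on_comparison_test)
  show "(\<lambda>n. 2 * (norm (x n))\<^sup>2 + 2 * (norm (y n))\<^sup>2) summable_on UNIV"
    by (intro summable_on_add summable_on_cmult_right assms)
  fix n
  have "(norm (x n + y n))\<^sup>2 \<le> (norm (x n) + norm (y n))\<^sup>2"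
    by (simp add: norm_triangle_ineq power_mono)
  also have "\<dots> \<le> 2 * (norm (x n))\<^sup>2 + 2 * (norm (y n))\<^sup>2"
    using zero_le_power2[of "norm (x n) - norm (y n)"]
    by (simp add: power2_eq_square algebra_simps)
  finally show "(norm (x n + y n))\<^sup>2 \<le> 2 * (norm (x n))\<^sup>2 + 2 * (norm (y n))\<^sup>2" .
qed simp

lemma square_summable_scaleC:
  fixes x :: "int \<Rightarrow> 'a::complex_inner"
  assumes "(\<lambda>n. (norm (x n))\<^sup>2) summable_on UNIV"
  shows "(\<lambda>n. (norm (c *\<^sub>C x n))\<^sup>2) summable_on UNIV"
  by (simp add: norm_scaleC power_mult_distrib summable_on_cmult_right assms)

lemma cinner_ell2Z_summable:
  "(\<lambda>n. cinner (nth_ell2Z x n) (nth_ell2Z y n)) summable_on UNIV"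
proof -
  have "(\<lambda>n. cmod (cinner (nth_ell2Z x n) (nth_ell2Z y n))) summable_on UNIV"
  proof (rule summable_on_comparison_test)
    show "(\<lambda>n. (norm (nth_ell2Z x n))\<^sup>2 + (norm (nth_ell2Z y n))\<^sup>2) summable_on UNIV"
      by (intro summable_on_add nth_ell2Z_summable)
    fix n
    let ?a = "norm (nth_ell2Z x n)" and ?b = "norm (nth_ell2Z y n)"
    have "2 * (?a * ?b) \<le> ?a\<^sup>2 + ?b\<^sup>2"
      using zero_le_power2[of "?a - ?b"] by (simp add: power2_eq_square algebra_simps)
    moreover have "0 \<le> ?a * ?b"
      by simp
    ultimately show "cmod (cinner (nth_ell2Z x n) (nth_ell2Z y n)) \<le> ?a\<^sup>2 + ?b\<^sup>2"
      using cmod_cinner_le[of "nth_ell2Z x n" "nth_ell2Z y n"] by linarith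
  qed simp
  then show ?thesis
    by (simp add: summable_on_iff_abs_summable_on_complex)
qed

instantiation ell2Z :: (complex_inner) complex_inner
begin

definition zero_ell2Z :: "'a ell2Z" where
  "0 = Abs_ell2Z (\<lambda>_. 0)"

definition plus_ell2Z :: "'a ell2Z \<Rightarrow> 'a ell2Z \<Rightarrow> 'a ell2Z" where
  "x + y = Abs_ell2Z (\<lambda>n. nth_ell2Z x n + nth_ell2Z y n)"

definition scaleC_ell2Z :: "complex \<Rightarrow> 'a ell2Z \<Rightarrow> 'a ell2Z" where
  "c *\<^sub>C x = Abs_ell2Z (\<lambda>n. c *\<^sub>C nth_ell2Z x n)"

definition scaleR_ell2Z :: "real \<Rightarrow> 'a ell2Z \<Rightarrow> 'a ell2Z" where
  "r *\<^sub>R x = complex_of_real r *\<^sub>C x" for x :: "'a ell2Z"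

definition uminus_ell2Z :: "'a ell2Z \<Rightarrow> 'a ell2Z" where
  "- x = (-1) *\<^sub>C x" for x :: "'a ell2Z"

definition minus_ell2Z :: "'a ell2Z \<Rightarrow> 'a ell2Z \<Rightarrow> 'a ell2Z" where
  "x - y = x + - y" for x y :: "'a ell2Z"

definition cinner_ell2Z :: "'a ell2Z \<Rightarrow> 'a ell2Z \<Rightarrow> complex" where
  "cinner x y = (\<Sum>\<^sub>\<infinity>n. cinner (nth_ell2Z x n) (nth_ell2Z y n))"

definition inner_ell2Z :: "'a ell2Z \<Rightarrow> 'a ell2Z \<Rightarrow> real" where
  "inner x y = Re (cinner x y)" for x y :: "'a ell2Z"

definition norm_ell2Z :: "'a ell2Z \<Rightarrow> real" where
  "norm x = sqrt (inner x x)" for x :: "'a ell2Z"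

definition sgn_ell2Z :: "'a ell2Z \<Rightarrow> 'a ell2Z" where
  "sgn x = inverse (norm x) *\<^sub>R x" for x :: "'a ell2Z"

definition dist_ell2Z :: "'a ell2Z \<Rightarrow> 'a ell2Z \<Rightarrow> real" where
  "dist x y = norm (x - y)" for x y :: "'a ell2Z"

definition uniformity_ell2Z :: "('a ell2Z \<times> 'a ell2Z) filter" where
  "uniformity = (INF e\<in>{0<..}. principal {(x :: 'a ell2Z, y). dist x y < e})"

definition open_ell2Z :: "'a ell2Z set \<Rightarrow> bool" where
  "open U \<longleftrightarrow> (\<forall>x\<in>U. eventually (\<lambda>(x', y). x' = x \<longrightarrow> y \<in> U) uniformity)"
    for U :: "'a ell2Z set"

lemma nth_zero [simp]: "nth_ell2Z 0 n = 0"
  by (simp add: zero_ell2Z_def Abs_ell2Z_inverse)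

lemma nth_plus [simp]: "nth_ell2Z (x + y) n = nth_ell2Z x n + nth_ell2Z y n"
  by (simp add: plus_ell2Z_def Abs_ell2Z_inverse square_summable_add nth_ell2Z_summable)

lemma nth_scaleC [simp]: "nth_ell2Z (c *\<^sub>C x) n = c *\<^sub>C nth_ell2Z x n"
  by (simp add: scaleC_ell2Z_def Abs_ell2Z_inverse square_summable_scaleC nth_ell2Z_summable)

lemma nth_scaleR [simp]: "nth_ell2Z (r *\<^sub>R x) n = r *\<^sub>R nth_ell2Z x n"
  by (simp add: scaleR_ell2Z_def scaleC_of_real)

lemma nth_uminus [simp]: "nth_ell2Z (- x) n = - nth_ell2Z x n"
  using scaleC_of_real[of "-1" "nth_ell2Z x n"] by (simp add: uminus_ell2Z_def)

lemma nth_minus [simp]: "nth_ell2Z (x - y) n = nth_ell2Z x n - nth_ell2Z y n"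
  by (simp add: minus_ell2Z_def)

lemma inner_ell2Z_self: "inner x x = (\<Sum>\<^sub>\<infinity>n. (norm (nth_ell2Z x n))\<^sup>2)" for x :: "'a ell2Z"
  unfolding inner_ell2Z_def cinner_ell2Z_def infsum_Re[OF cinner_ell2Z_summable, symmetric]
  by (simp add: cinner_self del: of_real_power)

instance
proof
  fix x y z :: "'a ell2Z" and r s :: real and c d :: complex and U :: "'a ell2Z set"
  show "x + y + z = x + (y + z)" "x + y = y + x" "0 + x = x" "- x + x = 0" "x - y = x + - y"
    by (rule ell2Z_eqI, simp add: algebra_simps)+
  show "r *\<^sub>R (x + y) = r *\<^sub>R x + r *\<^sub>R y" "(r + s) *\<^sub>R x = r *\<^sub>R x + s *\<^sub>R x"
    "r *\<^sub>R s *\<^sub>R x = (r * s) *\<^sub>R x" "1 *\<^sub>R x = x"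
    by (rule ell2Z_eqI, simp add: algebra_simps)+
  show "c *\<^sub>C (x + y) = c *\<^sub>C x + c *\<^sub>C y" "(c + d) *\<^sub>C x = c *\<^sub>C x + d *\<^sub>C x"
    "c *\<^sub>C d *\<^sub>C x = (c * d) *\<^sub>C x" "complex_of_real r *\<^sub>C x = r *\<^sub>R x"
    by (rule ell2Z_eqI, simp add: scaleC_add_right scaleC_add_left scaleC_scaleC scaleC_of_real)+
  show commute: "cinner x y = cnj (cinner y x)" for x y :: "'a ell2Z"
    unfolding cinner_ell2Z_def infsum_cnj[symmetric] by (intro infsum_cong cinner_commute)
  show add: "cinner (x + y) z = cinner x z + cinner y z"
    by (simp add: cinner_ell2Z_def cinner_add_left infsum_add cinner_ell2Z_summable)
  show scale: "cinner (c *\<^sub>C x) y = c * cinner x y" for c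
    by (simp add: cinner_ell2Z_def cinner_scaleC_left infsum_cmult_right')
  show "inner x y = Re (cinner x y)"
    by (rule inner_ell2Z_def)
  show "inner x y = inner y x"
    using commute[of x y] by (simp add: inner_ell2Z_def)
  show "inner (x + y) z = inner x z + inner y z"
    by (simp add: inner_ell2Z_def add)
  show "inner (r *\<^sub>R x) y = r * inner x y"
    by (simp add: inner_ell2Z_def scaleR_ell2Z_def scale)
  show "0 \<le> inner x x"
    by (simp add: inner_ell2Z_self infsum_nonneg)
  show "inner x x = 0 \<longleftrightarrow> x = 0"
  proof
    assume "inner x x = 0"
    then have le: "(\<Sum>\<^sub>\<infinity>n. (norm (nth_ell2Z x n))\<^sup>2) \<le> 0"
      by (simp add: inner_ell2Z_self)
    have "(norm (nth_ell2Z x n))\<^sup>2 = 0" for n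
      by (rule nonneg_infsum_le_0D[OF le nth_ell2Z_summable]) simp_all
    then show "x = 0"
      by (intro ell2Z_eqI) simp
  qed (simp add: inner_ell2Z_self)
  show "norm x = sqrt (inner x x)"
    by (rule norm_ell2Z_def)
  show "sgn x = inverse (norm x) *\<^sub>R x"
    by (rule sgn_ell2Z_def)
  show "dist x y = norm (x - y)"
    by (rule dist_ell2Z_def)
  show "uniformity = (INF e\<in>{0<..}. principal {(x :: 'a ell2Z, y). dist x y < e})"
    by (rule uniformity_ell2Z_def)
  show "open U \<longleftrightarrow> (\<forall>x\<in>U. eventually (\<lambda>(x', y). x' = x \<longrightarrow> y \<in> U) uniformity)"
    by (rule open_ell2Z_def)
qed

end

lemma norm_ell2Z_square: "(norm x)\<^sup>2 = (\<Sum>\<^sub>\<infinity>n. (norm (nth_ell2Z x n))\<^sup>2)"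
  by (simp add: power2_norm_eq_inner inner_ell2Z_self)

lemma sum_le_norm_ell2Z_square:
  "finite F \<Longrightarrow> (\<Sum>n\<in>F. (norm (nth_ell2Z x n))\<^sup>2) \<le> (norm x)\<^sup>2"
  unfolding norm_ell2Z_square by (rule finite_sum_le_infsum[OF nth_ell2Z_summable]) simp_all

lemma norm_nth_ell2Z_le: "norm (nth_ell2Z x n) \<le> norm x"
  using sum_le_norm_ell2Z_square[of "{n}" x] by (simp add: power2_le_iff_abs_le)

instance ell2Z :: (chilbert_space) chilbert_space
proof
  fix X :: "nat \<Rightarrow> 'a ell2Z"
  assume X: "Cauchy X"
  have "Cauchy (\<lambda>k. nth_ell2Z (X k) n)" for n
  proof (rule metric_CauchyI)
    fix e :: real
    assume "0 < e"
    with X obtain M where M: "\<And>k m. k \<ge> M \<Longrightarrow> m \<ge> M \<Longrightarrow> dist (X k) (X m) < e"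
      by (meson metric_CauchyD)
    have "dist (nth_ell2Z (X k) n) (nth_ell2Z (X m) n) \<le> dist (X k) (X m)" for k m
      using norm_nth_ell2Z_le[of "X k - X m" n] by (simp add: dist_norm)
    then show "\<exists>M. \<forall>k\<ge>M. \<forall>m\<ge>M. dist (nth_ell2Z (X k) n) (nth_ell2Z (X m) n) < e"
      using M by (meson le_less_trans)
  qed
  then have "\<exists>l. (\<lambda>k. nth_ell2Z (X k) n) \<longlonglongrightarrow> l" for n
    using Cauchy_convergent convergent_def by blast
  then obtain L where L: "\<And>n. (\<lambda>k. nth_ell2Z (X k) n) \<longlonglongrightarrow> L n"
    by metis
  have bound: "\<exists>M. \<forall>k\<ge>M. \<forall>F. finite F \<longrightarrow> (\<Sum>n\<in>F. (norm (nth_ell2Z (X k) n - L n))\<^sup>2) \<le> e\<^sup>2"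
    if "0 < e" for e
  proof -
    from X that obtain M where M: "\<And>k m. k \<ge> M \<Longrightarrow> m \<ge> M \<Longrightarrow> dist (X k) (X m) < e"
      by (meson metric_CauchyD)
    have "(\<Sum>n\<in>F. (norm (nth_ell2Z (X k) n - L n))\<^sup>2) \<le> e\<^sup>2" if k: "k \<ge> M" and F: "finite F" for k F
    proof (rule LIMSEQ_le_const2)
      show "(\<lambda>m. \<Sum>n\<in>F. (norm (nth_ell2Z (X k) n - nth_ell2Z (X m) n))\<^sup>2)
          \<longlonglongrightarrow> (\<Sum>n\<in>F. (norm (nth_ell2Z (X k) n - L n))\<^sup>2)"
        by (intro tendsto_intros L)
      have "(\<Sum>n\<in>F. (norm (nth_ell2Z (X k) n - nth_ell2Z (X m) n))\<^sup>2) \<le> e\<^sup>2" if "m \<ge> M" for m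
      proof -
        have "(\<Sum>n\<in>F. (norm (nth_ell2Z (X k) n - nth_ell2Z (X m) n))\<^sup>2) \<le> (norm (X k - X m))\<^sup>2"
          using sum_le_norm_ell2Z_square[OF F, of "X k - X m"] by simp
        also have "\<dots> \<le> e\<^sup>2"
          using M[OF k that] by (intro power_mono) (simp_all add: dist_norm)
        finally show ?thesis .
      qed
      then show "\<exists>N. \<forall>m\<ge>N. (\<Sum>n\<in>F. (norm (nth_ell2Z (X k) n - nth_ell2Z (X m) n))\<^sup>2) \<le> e\<^sup>2"
        by blast
    qed
    then show ?thesis
      by blast
  qed
  have diff_summable: "(\<lambda>n. (norm (nth_ell2Z (X k) n - L n))\<^sup>2) summable_on UNIV"
    if "\<forall>F. finite F \<longrightarrow> (\<Sum>n\<in>F. (norm (nth_ell2Z (X k) n - L n))\<^sup>2) \<le> e\<^sup>2" for k and e :: real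
    by (rule nonneg_bounded_partial_sums_imp_summable_on[where C = "e\<^sup>2"])
      (use that in \<open>auto simp: eventually_finite_subsets_at_top\<close>)
  obtain M where "\<forall>F. finite F \<longrightarrow> (\<Sum>n\<in>F. (norm (nth_ell2Z (X M) n - L n))\<^sup>2) \<le> 1\<^sup>2"
    using bound[of 1] by auto
  then have "(\<lambda>n. (norm (nth_ell2Z (X M) n - L n))\<^sup>2) summable_on UNIV"
    by (rule diff_summable)
  then have "(\<lambda>n. (norm (L n - nth_ell2Z (X M) n))\<^sup>2) summable_on UNIV"
    by (simp add: norm_minus_commute)
  from square_summable_add[OF this nth_ell2Z_summable[of "X M"]]
  have "(\<lambda>n. (norm (L n))\<^sup>2) summable_on UNIV"
    by simp
  then have nth_L: "nth_ell2Z (Abs_ell2Z L) = L"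
    by (simp add: Abs_ell2Z_inverse)
  have "X \<longlonglongrightarrow> Abs_ell2Z L"
  proof (rule metric_LIMSEQ_I)
    fix e :: real
    assume "0 < e"
    then obtain M where M: "\<And>k F. k \<ge> M \<Longrightarrow> finite F \<Longrightarrow>
        (\<Sum>n\<in>F. (norm (nth_ell2Z (X k) n - L n))\<^sup>2) \<le> (e / 2)\<^sup>2"
      using bound[of "e / 2"] by auto
    have "dist (X k) (Abs_ell2Z L) < e" if "k \<ge> M" for k
    proof -
      have "(norm (X k - Abs_ell2Z L))\<^sup>2 \<le> (e / 2)\<^sup>2"
        unfolding norm_ell2Z_square
        by (rule infsum_le_finite_sums[OF nth_ell2Z_summable])
          (simp add: nth_L M[OF that] del: power_divide)
      then have "norm (X k - Abs_ell2Z L) \<le> e / 2"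
        by (rule power2_le_imp_le) (use \<open>0 < e\<close> in simp)
      then show ?thesis
        using \<open>0 < e\<close> by (simp add: dist_norm)
    qed
    then show "\<exists>M. \<forall>k\<ge>M. dist (X k) (Abs_ell2Z L) < e"
      by blast
  qed
  then show "convergent X"
    by (rule convergentI)
qed

definition bilateral_weighted_shift ::
    "('h::complex_inner ell2Z \<Rightarrow> 'h ell2Z) \<Rightarrow> (int \<Rightarrow> 'h \<Rightarrow> 'h) \<Rightarrow> bool" where
  "bilateral_weighted_shift S W \<longleftrightarrow>
     (\<forall>n. bounded_clinear (W n) \<and> W n \<noteq> (\<lambda>_. 0)) \<and>
     bdd_above (range (\<lambda>n. onorm (W n))) \<and>
     bounded_clinear S \<and>
     (\<forall>x n. nth_ell2Z (S x) n = W n (nth_ell2Z x (n - 1)))"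

end

theory Submission
  imports Defs
begin

text \<open>
  A diagonal unitary \<open>U = \<Oplus> U\<^sub>n\<close> turns \<open>S\<close> into the shift with weights \<open>T\<^sub>n = U\<^sub>n S\<^sub>n U\<^sub>n\<^sub>-\<^sub>1\<^sup>*\<close>. A quasi-invertible
  operator has a polar decomposition with unitary part, on the left or on the right; so, starting
  from \<open>U\<^sub>0 = I\<close>, one chooses \<open>U\<^sub>n\<close> from \<open>U\<^sub>n\<^sub>-\<^sub>1\<close> for \<open>n > 0\<close> and \<open>U\<^sub>n\<^sub>-\<^sub>1\<close> from \<open>U\<^sub>n\<close> for \<open>n \<le> 0\<close>, making every
  \<open>T\<^sub>n\<close> positive.
\<close>

text \<open>Makes results on absolutely convergent series in Banach spaces applicable to power
  series in an operator.\<close>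

instance chilbert_space \<subseteq> banach ..

section \<open>Orthogonality in Hilbert spaces\<close>

text \<open>Minimising \<open>\<parallel>y\<parallel>\<^sup>2 - 2 f y\<close> over a closed subspace yields both the Riesz representation theorem
  (whole space) and the orthogonal projection (\<open>f = inner x\<close>).\<close>

lemma Riesz_on_subspace:
  fixes f :: "'a::{real_inner, complete_space} \<Rightarrow> real"
  assumes M: "subspace M" "closed M" and f: "bounded_linear f"
  shows "\<exists>z\<in>M. \<forall>y\<in>M. inner z y = f y"
proof -
  interpret f: bounded_linear f by (rule f)
  define g where "g y = (norm y)\<^sup>2 - 2 * f y" for y
  obtain K where K: "\<And>y. \<bar>f y\<bar> \<le> norm y * K"
    using f.bounded by auto
  \<comment> \<open>Completing the square shows that \<open>g\<close> is bounded below, so its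
    infimum \<open>m\<close> over \<open>M\<close> exists.\<close>
  have g_lower: "- (K\<^sup>2) \<le> g y" for y
  proof -
    have "0 \<le> (norm y - K)\<^sup>2" by simp
    then show ?thesis
      using K[of y] by (simp add: g_def power2_eq_square algebra_simps)
  qed
  define m where "m = Inf (g ` M)"
  have ne: "M \<noteq> {}" using M subspace_0 by blast
  have bdd: "bdd_below (g ` M)" by (rule bdd_belowI2) (rule g_lower)
  have m_le: "m \<le> g y" if "y \<in> M" for y
    unfolding m_def using bdd that by (rule cINF_lower)
  have "\<exists>y\<in>M. g y < m + inverse (real (Suc n))" for n
    using cINF_less_iff[OF ne bdd, of "m + inverse (real (Suc n))"] by (simp add: m_def)
  then obtain y where y: "\<And>n. y n \<in> M" "\<And>n. g (y n) < m + inverse (real (Suc n))"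
    by metis
  \<comment> \<open>Parallelogram identity: the midpoint of \<open>u\<close> and \<open>v\<close>
    lies in \<open>M\<close>, where \<open>g\<close> is at least \<open>m\<close>. Near-minimisers
    are therefore close together, and a minimising sequence is Cauchy.\<close>
  have par: "(norm (u - v))\<^sup>2 \<le> 2 * (g u + g v - 2 * m)" if "u \<in> M" "v \<in> M" for u v
  proof -
    have "(1 / 2) *\<^sub>R (u + v) \<in> M"
      using M that by (simp add: subspace_add subspace_mul)
    then have "m \<le> g ((1 / 2) *\<^sub>R (u + v))"
      by (rule m_le)
    moreover have "(norm ((1 / 2) *\<^sub>R (u + v)))\<^sup>2 = ((norm u)\<^sup>2 + (norm v)\<^sup>2) / 2 - (norm (u - v))\<^sup>2 / 4"
      unfolding power2_norm_eq_inner inner_add_left inner_add_right inner_diff_left inner_diff_right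
        inner_commute[of v u] inner_scaleR_left inner_scaleR_right
      by (simp add: field_simps)
    moreover have "f ((1 / 2) *\<^sub>R (u + v)) = (f u + f v) / 2"
      unfolding f.scaleR f.add by simp
    ultimately show ?thesis
      unfolding g_def by argo
  qed
  have "Cauchy y"
  proof (rule metric_CauchyI)
    fix e :: real assume e: "0 < e"
    then have "0 < e\<^sup>2 / 4" by simp
    then obtain N where N: "inverse (real (Suc N)) < e\<^sup>2 / 4"
      using reals_Archimedean by blast
    have gN: "g (y k) < m + e\<^sup>2 / 4" if "k \<ge> N" for k
    proof -
      have "inverse (real (Suc k)) \<le> inverse (real (Suc N))"
        using that by (simp add: le_imp_inverse_le)
      with y(2)[of k] N show ?thesis by linarith
    qed
    have "dist (y k) (y l) < e" if "k \<ge> N" "l \<ge> N" for k l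
    proof -
      have "(norm (y k - y l))\<^sup>2 < e\<^sup>2"
        using par[OF y(1) y(1), of k l] gN[OF that(1)] gN[OF that(2)] by argo
      then show ?thesis
        using e by (simp add: dist_norm power2_less_imp_less)
    qed
    then show "\<exists>N. \<forall>k\<ge>N. \<forall>l\<ge>N. dist (y k) (y l) < e" by blast
  qed
  then obtain z where z: "y \<longlonglongrightarrow> z"
    using Cauchy_convergent convergent_def by blast
  have zM: "z \<in> M"
    using M(2) y(1) z closed_sequentially by blast
  have "(\<lambda>n. g (y n)) \<longlonglongrightarrow> g z"
    unfolding g_def by (intro tendsto_intros z f.tendsto)
  moreover have "(\<lambda>n. m + inverse (real (Suc n))) \<longlonglongrightarrow> m + 0"
    by (intro tendsto_intros LIMSEQ_inverse_real_of_nat)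
  ultimately have gz: "g z \<le> m"
    using y(2) by (intro LIMSEQ_le[of "\<lambda>n. g (y n)" "g z" "\<lambda>n. m + inverse (real (Suc n))" m])
      (auto intro: less_imp_le)
  have "inner z v = f v" if "v \<in> M" for v
  proof (cases "v = 0")
    case False
    define d where "d = inner z v - f v"
    \<comment> \<open>This \<open>t\<close> minimises the quadratic polynomial
      \<open>g (z + t v)\<close>; it would lower \<open>g z\<close> by
      \<open>d^2 / (norm v)^2\<close>, so minimality of \<open>z\<close> forces
      \<open>d = 0\<close>.\<close>
    define t where "t = - d / (norm v)\<^sup>2"
    have "z + t *\<^sub>R v \<in> M"
      using M zM that by (simp add: subspace_add subspace_mul)
    with gz have "g z \<le> g (z + t *\<^sub>R v)"
      using m_le order_trans by blast
    moreover have "g (z + t *\<^sub>R v) = g z + (t\<^sup>2 * (norm v)\<^sup>2 + 2 * t * d)"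
      unfolding g_def d_def power2_norm_eq_inner inner_add_left inner_add_right inner_commute[of v z]
        inner_scaleR_left inner_scaleR_right f.add f.scaleR
      by (simp add: power2_eq_square algebra_simps)
    moreover have "t\<^sup>2 * (norm v)\<^sup>2 + 2 * t * d = - (d\<^sup>2 / (norm v)\<^sup>2)"
      using False by (simp add: t_def power2_eq_square field_simps)
    ultimately have "d\<^sup>2 / (norm v)\<^sup>2 \<le> 0" by simp
    then have "d = 0"
      using False by (simp add: divide_le_0_iff)
    then show ?thesis by (simp add: d_def)
  qed (simp add: f.zero)
  with zM show ?thesis by blast
qed

lemma subspace_closure:
  fixes M :: "'a::real_normed_vector set"
  assumes "subspace M"
  shows "subspace (closure M)"
proof (rule subspaceI)
  show "0 \<in> closure M"
    using subspace_0[OF assms] closure_subset by blast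
next
  fix x y assume "x \<in> closure M" "y \<in> closure M"
  then obtain f g where f: "\<And>n. f n \<in> M" "f \<longlonglongrightarrow> x" and g: "\<And>n. g n \<in> M" "g \<longlonglongrightarrow> y"
    by (meson closure_sequential)
  have "(\<lambda>n. f n + g n) \<longlonglongrightarrow> x + y"
    by (intro tendsto_intros f g)
  then show "x + y \<in> closure M"
    using f(1) g(1) subspace_add[OF assms] closure_sequential[of _ M] by fast
next
  fix c x assume "x \<in> closure M"
  then obtain f where f: "\<And>n. f n \<in> M" "f \<longlonglongrightarrow> x"
    by (meson closure_sequential)
  have "(\<lambda>n. c *\<^sub>R f n) \<longlonglongrightarrow> c *\<^sub>R x"
    by (intro tendsto_intros f)
  then show "c *\<^sub>R x \<in> closure M"
    using f(1) subspace_mul[OF assms] closure_sequential[of _ M] by fast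
qed

text \<open>The point \<open>z\<close> is the orthogonal projection of \<open>x\<close> onto the
  closure; \<open>x - z\<close> is orthogonal to \<open>M\<close> and hence vanishes.\<close>

lemma dense_subspace:
  fixes M :: "'a::{real_inner, complete_space} set"
  assumes M: "subspace M" and orth: "\<And>x. (\<And>y. y \<in> M \<Longrightarrow> inner x y = 0) \<Longrightarrow> x = 0"
  shows "closure M = UNIV"
proof -
  have "x \<in> closure M" for x
  proof -
    obtain z where z: "z \<in> closure M" "\<forall>y\<in>closure M. inner z y = inner x y"
      using Riesz_on_subspace[OF subspace_closure[OF M] closed_closure bounded_linear_inner_right[of x]]
      by (rule bexE)
    have "x - z = 0"
      by (rule orth) (simp add: inner_diff_left z(2) subsetD[OF closure_subset])
    with z(1) show ?thesis by simp
  qed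
  then show ?thesis by auto
qed

section \<open>The binomial series of the square root\<close>

text \<open>The Taylor coefficients of \<open>sqrt (1 - t)\<close> at \<open>t = 0\<close>.\<close>

definition sqrt_coeff :: "nat \<Rightarrow> real" where
  "sqrt_coeff k = (1 / 2 gchoose k) * (-1) ^ k"

lemma sqrt_coeff_0 [simp]: "sqrt_coeff 0 = 1"
  by (simp add: sqrt_coeff_def)

text \<open>The coefficient at index 1 is \<open>-1/2\<close>, and from there on the ratio of
  successive coefficients is positive.\<close>

lemma sqrt_coeff_nonpos: "sqrt_coeff (Suc k) \<le> 0"
proof (induction k)
  case 0
  show ?case by (simp add: sqrt_coeff_def)
next
  case (Suc k)
  have "sqrt_coeff (Suc (Suc k)) = sqrt_coeff (Suc k) * ((real k + 1 / 2) / (real k + 2))"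
    by (simp add: sqrt_coeff_def gbinomial_prod_rev field_simps)
  with mult_nonpos_nonneg[OF Suc, of "(real k + 1 / 2) / (real k + 2)"] show ?case
    by simp
qed

text \<open>The partial sums have the closed form \<open>(-1)^n * (-1/2 gchoose n)\<close>, a
  product of the positive factors \<open>(k + 1/2) / (k + 1)\<close>.\<close>

lemma sum_sqrt_coeff_nonneg: "0 \<le> (\<Sum>k\<le>n. sqrt_coeff k)"
proof -
  have "0 \<le> (-1) ^ n * ((1 / 2 :: real) - 1 gchoose n)"
  proof (induction n)
    case (Suc n)
    have "(-1) ^ Suc n * ((1 / 2 :: real) - 1 gchoose Suc n)
        = (-1) ^ n * ((1 / 2 :: real) - 1 gchoose n) * ((real n + 1 / 2) / (real n + 1))"
      by (simp add: gbinomial_prod_rev field_simps)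
    with Suc show ?case
      by simp
  qed simp
  then show ?thesis
    by (simp add: sqrt_coeff_def gbinomial_sum_lower_neg)
qed

text \<open>Only the leading coefficient 1 is positive, so a sum of absolute values is 2 minus the
  signed sum; the latter is nonnegative, which gives the bound 2.\<close>

lemma sqrt_coeff_abs_summable: "(\<lambda>k. norm (sqrt_coeff k)) summable_on UNIV"
proof -
  have eq: "(\<Sum>k<Suc n. norm (sqrt_coeff k)) = 2 - (\<Sum>k\<le>n. sqrt_coeff k)" for n
    by (induction n) (use sqrt_coeff_nonpos in \<open>auto simp: atMost_Suc abs_of_nonpos\<close>)
  have "(\<Sum>k<n. norm (sqrt_coeff k)) \<le> 2" for n
    by (cases n) (use eq sum_sqrt_coeff_nonneg in \<open>auto simp del: sum.lessThan_Suc\<close>)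
  then have "summable (\<lambda>k. norm (sqrt_coeff k))"
    by (intro summableI_nonneg_bounded[where x = 2]) auto
  then show ?thesis
    by (intro norm_summable_imp_summable_on) simp
qed

lemma infsum_sqrt_coeff_nonneg: "0 \<le> (\<Sum>\<^sub>\<infinity>k. sqrt_coeff k)"
proof -
  have "sqrt_coeff summable_on UNIV"
    using sqrt_coeff_abs_summable by (rule abs_summable_summable)
  then have "sqrt_coeff sums (\<Sum>\<^sub>\<infinity>k. sqrt_coeff k)"
    by (intro has_sum_imp_sums) simp
  then have "(\<lambda>n. \<Sum>k\<le>n. sqrt_coeff k) \<longlonglongrightarrow> (\<Sum>\<^sub>\<infinity>k. sqrt_coeff k)"
    by (simp add: sums_def_le)
  then show ?thesis
    by (rule LIMSEQ_le_const) (use sum_sqrt_coeff_nonneg in blast)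
qed

text \<open>The square of the formal series is \<open>1 - t\<close>: Vandermonde with
  \<open>1/2 + 1/2 = 1\<close> reduces the convolution to \<open>1 choose n\<close>.\<close>

lemma sqrt_coeff_convolution:
  "(\<Sum>i\<le>n. sqrt_coeff i * sqrt_coeff (n - i)) = (if n = 0 then 1 else if n = 1 then - 1 else 0)"
proof -
  have "(\<Sum>i\<le>n. sqrt_coeff i * sqrt_coeff (n - i))
      = (\<Sum>i\<le>n. (1 / 2 gchoose i) * (1 / 2 gchoose (n - i))) * (-1) ^ n"
    unfolding sum_distrib_right
  proof (rule sum.cong)
    fix i assume "i \<in> {..n}"
    then have "(-1 :: real) ^ n = (-1) ^ i * (-1) ^ (n - i)"
      by (simp flip: power_add)
    then show "sqrt_coeff i * sqrt_coeff (n - i) = (1 / 2 gchoose i) * (1 / 2 gchoose (n - i)) * (-1) ^ n"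
      by (simp add: sqrt_coeff_def)
  qed simp
  also have "(\<Sum>i\<le>n. (1 / 2 gchoose i) * (1 / 2 gchoose (n - i))) = (1 :: real) gchoose n"
    using gbinomial_Vandermonde[of "1 / 2 :: real" "1 / 2" n] by (simp add: atLeast0AtMost)
  also have "(1 :: real) gchoose n = real (1 choose n)"
    using binomial_gbinomial[of 1 n, where 'a = real] by simp
  also have "\<dots> * (-1) ^ n = (if n = 0 then 1 else if n = 1 then - 1 else 0)"
    by (auto simp: binomial_eq_0)
  finally show ?thesis .
qed

text \<open>Absolute summability of the double family allows regrouping it along the diagonals
  \<open>n = j + k\<close>. In the application \<open>v n\<close> is the \<open>n\<close>-th power
  of an operator at a fixed vector.\<close>

lemma infsum_Cauchy_product:
  fixes a b :: "nat \<Rightarrow> real" and v :: "nat \<Rightarrow> 'a::banach"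
  assumes a: "(\<lambda>k. norm (a k)) summable_on UNIV" and b: "(\<lambda>k. norm (b k)) summable_on UNIV"
    and v: "\<And>n. norm (v n) \<le> M"
  shows "(\<Sum>\<^sub>\<infinity>j. \<Sum>\<^sub>\<infinity>k. (a j * b k) *\<^sub>R v (j + k)) = (\<Sum>\<^sub>\<infinity>n. (\<Sum>i\<le>n. a i * b (n - i)) *\<^sub>R v n)"
proof -
  let ?h = "\<lambda>(j, k). (a j * b k) *\<^sub>R v (j + k)"
  let ?g = "\<lambda>(n, i). (a i * b (n - i)) *\<^sub>R v n"
  have "(\<lambda>(j, k). norm (a j) * norm (b k)) summable_on UNIV \<times> UNIV"
    by (intro summable_on_SigmaI[where g = "\<lambda>j. norm (a j) * infsum (\<lambda>k. norm (b k)) UNIV"])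
      (use a b in \<open>auto intro!: has_sum_cmult_right has_sum_infsum summable_on_cmult_left\<close>)
  then have "(\<lambda>p. (case p of (j, k) \<Rightarrow> norm (a j) * norm (b k)) * M) summable_on UNIV \<times> UNIV"
    by (rule summable_on_cmult_left)
  then have "(\<lambda>p. norm (?h p)) summable_on UNIV \<times> UNIV"
    by (rule Infinite_Sum.abs_summable_on_comparison_test')
      (auto simp: abs_mult intro!: mult_left_mono v)
  then have sh: "?h summable_on UNIV \<times> UNIV"
    by (rule abs_summable_summable)
  have bij: "bij_betw (\<lambda>(n, i). (i, n - i)) (SIGMA n:UNIV. {..n}) (UNIV \<times> (UNIV :: nat set))"
    by (rule bij_betwI[where g = "\<lambda>(j, k). (j + k, j)"]) auto
  have eq: "?h (case p of (n, i) \<Rightarrow> (i, n - i)) = ?g p" if "p \<in> (SIGMA n:UNIV. {..n})" for p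
    using that by auto
  have sg: "?g summable_on (SIGMA n:UNIV. {..n})"
    by (rule iffD1[OF summable_on_cong[OF eq]], assumption)
      (rule iffD2[OF summable_on_reindex_bij_betw[OF bij] sh])
  have "(\<Sum>\<^sub>\<infinity>j. \<Sum>\<^sub>\<infinity>k. (a j * b k) *\<^sub>R v (j + k)) = infsum ?h (UNIV \<times> UNIV)"
    using infsum_Sigma_banach[OF sh] by simp
  also have "\<dots> = infsum (\<lambda>p. ?h (case p of (n, i) \<Rightarrow> (i, n - i))) (SIGMA n:UNIV. {..n})"
    by (rule infsum_reindex_bij_betw[OF bij, symmetric])
  also have "\<dots> = infsum ?g (SIGMA n:UNIV. {..n})"
    by (rule infsum_cong) (rule eq)
  also have "\<dots> = (\<Sum>\<^sub>\<infinity>n. \<Sum>\<^sub>\<infinity>i\<in>{..n}. (a i * b (n - i)) *\<^sub>R v n)"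
    using infsum_Sigma_banach[OF sg] by simp
  also have "\<dots> = (\<Sum>\<^sub>\<infinity>n. (\<Sum>i\<le>n. a i * b (n - i)) *\<^sub>R v n)"
    by (simp add: scaleR_sum_left)
  finally show ?thesis .
qed

section \<open>Positive square roots\<close>

lemma bounded_clinearI:
  assumes "\<And>x y. A (x + y) = A x + A y" "\<And>c x. A (c *\<^sub>C x) = c *\<^sub>C A x"
    and "\<And>x. norm (A x) \<le> norm x * K"
  shows "bounded_clinear A"
  unfolding bounded_clinear_def
proof
  show "bounded_linear A"
    by (rule bounded_linear_intro[OF assms(1) _ assms(3)])
      (use assms(2) in \<open>simp flip: scaleC_of_real\<close>)
qed (use assms(2) in blast)

lemma bounded_clinear_bounded_linear: "bounded_clinear A \<Longrightarrow> bounded_linear A"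
  by (simp add: bounded_clinear_def)

lemma bounded_clinear_scaleC: "bounded_clinear A \<Longrightarrow> A (c *\<^sub>C x) = c *\<^sub>C A x"
  by (simp add: bounded_clinear_def)

lemma bounded_clinear_compose:
  "bounded_clinear A \<Longrightarrow> bounded_clinear B \<Longrightarrow> bounded_clinear (A \<circ> B)"
  unfolding bounded_clinear_def comp_def by (auto intro: bounded_linear_compose)

text \<open>With \<open>inner_eq_Re_cinner\<close> this recovers the complex inner product from the
  real one.\<close>

lemma Im_cinner: "Im (cinner x y) = - inner (\<i> *\<^sub>C x) y"
  by (simp add: inner_eq_Re_cinner cinner_scaleC_left)

lemma inner_scaleC_right: "inner x (c *\<^sub>C y) = inner (cnj c *\<^sub>C x) y"
proof -
  have "cinner x (c *\<^sub>C y) = cinner (cnj c *\<^sub>C x) y"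
    by (metis cinner_commute cinner_scaleC_left complex_cnj_cnj complex_cnj_mult)
  then show ?thesis
    by (simp add: inner_eq_Re_cinner)
qed

lemma scaleC_scaleR: "c *\<^sub>C r *\<^sub>R x = r *\<^sub>R c *\<^sub>C x" for x :: "'a::complex_inner"
  by (simp add: scaleC_scaleC mult.commute flip: scaleC_of_real)

lemma bounded_linear_scaleC: "bounded_linear (\<lambda>x :: 'a::complex_inner. c *\<^sub>C x)"
  by (rule bounded_linear_intro[where K = "cmod c"])
    (simp_all add: scaleC_add_right scaleC_scaleR norm_scaleC)

text \<open>Real symmetry suffices for a complex-linear \<open>A\<close>: applied to
  \<open>\<i>\<close> times \<open>x\<close>, it shows that the imaginary part of
  \<open>cinner (A x) x\<close> equals its own negative.\<close>

lemma positive_opI: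
  assumes A: "bounded_clinear A" and sym: "\<And>x y. inner (A x) y = inner x (A y)"
    and nonneg: "\<And>x. 0 \<le> inner (A x) x"
  shows "positive_op A"
proof -
  have "Im (cinner (A x) x) = 0" for x
  proof -
    have "Im (cinner (A x) x) = - inner (\<i> *\<^sub>C x) (A x)"
      by (simp add: Im_cinner sym flip: bounded_clinear_scaleC[OF A])
    also have "\<dots> = Im (cinner x (A x))"
      by (simp add: Im_cinner)
    also have "\<dots> = - Im (cinner (A x) x)"
      using cinner_commute[of x "A x"] by simp
    finally show ?thesis by simp
  qed
  then show ?thesis
    using A nonneg by (simp add: positive_op_def complex_nonneg_Reals_iff inner_eq_Re_cinner)
qed

text \<open>The root is the binomial series of \<open>sqrt (1 - C)\<close>. Its coefficients are \<open>1\<close> followed by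
  nonpositive numbers whose sum is at least \<open>-1\<close>, so positivity needs only that \<open>C\<close> is a contraction.\<close>

lemma ex_positive_sqrt:
  fixes C :: "'a::chilbert_space \<Rightarrow> 'a"
  assumes C: "bounded_clinear C" and sym: "\<And>x y. inner (C x) y = inner x (C y)"
    and contraction: "\<And>x. norm (C x) \<le> norm x"
  shows "\<exists>P. positive_op P \<and> (\<forall>x y. inner (P x) y = inner x (P y)) \<and> (\<forall>x. P (P x) = x - C x)"
proof -
  interpret C: bounded_linear C
    using C by (rule bounded_clinear_bounded_linear)
  have pow_norm: "norm ((C ^^ k) x) \<le> norm x" for k x
    by (induction k) (auto intro: order_trans[OF contraction])
  have pow_sym: "inner ((C ^^ k) x) y = inner x ((C ^^ k) y)" for k x y
    by (induction k arbitrary: x y) (simp_all add: sym funpow_swap1)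
  have pow_add: "(C ^^ k) (x + y) = (C ^^ k) x + (C ^^ k) y" for k x y
    by (induction k) (simp_all add: C.add)
  have pow_scaleC: "(C ^^ k) (c *\<^sub>C x) = c *\<^sub>C (C ^^ k) x" for k c x
    by (induction k) (simp_all add: bounded_clinear_scaleC[OF C])
  have pow_bl: "bounded_linear (C ^^ k)" for k
    by (rule bounded_clinear_bounded_linear, rule bounded_clinearI[where K = 1])
      (simp_all add: pow_add pow_scaleC pow_norm)
  define P where "P x = (\<Sum>\<^sub>\<infinity>k. sqrt_coeff k *\<^sub>R (C ^^ k) x)" for x
  \<comment> \<open>The powers of a contraction are contractions, so the coefficient series
    dominates the operator series.\<close>
  have bnd: "norm (sqrt_coeff k *\<^sub>R (C ^^ k) x) \<le> norm (sqrt_coeff k) * norm x" for k x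
    by (simp add: mult_left_mono pow_norm)
  have sum_bnd: "(\<lambda>k. norm (sqrt_coeff k) * norm x) summable_on UNIV" for x :: 'a
    by (intro summable_on_cmult_left sqrt_coeff_abs_summable)
  have abs: "(\<lambda>k. norm (sqrt_coeff k *\<^sub>R (C ^^ k) x)) summable_on UNIV" for x
    by (rule Infinite_Sum.abs_summable_on_comparison_test'[OF sum_bnd bnd])
  have P: "((\<lambda>k. sqrt_coeff k *\<^sub>R (C ^^ k) x) has_sum P x) UNIV" for x
    unfolding P_def by (rule has_sum_infsum[OF abs_summable_summable[OF abs]])
  have "bounded_clinear P"
  proof (rule bounded_clinearI)
    show "P (x + y) = P x + P y" for x y
      using has_sum_add[OF P[of x] P[of y]]
      by (intro has_sum_unique[OF P]) (simp only: pow_add scaleR_add_right)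
    show "P (c *\<^sub>C x) = c *\<^sub>C P x" for c x
      using has_sum_bounded_linear[OF bounded_linear_scaleC P[of x], of c]
      by (intro has_sum_unique[OF P]) (simp only: pow_scaleC scaleC_scaleR)
    show "norm (P x) \<le> norm x * (\<Sum>\<^sub>\<infinity>k. norm (sqrt_coeff k))" for x
    proof -
      have "norm (P x) \<le> (\<Sum>\<^sub>\<infinity>k. norm (sqrt_coeff k *\<^sub>R (C ^^ k) x))"
        unfolding P_def by (rule norm_infsum_bound[OF abs])
      also have "\<dots> \<le> (\<Sum>\<^sub>\<infinity>k. norm (sqrt_coeff k) * norm x)"
        by (rule infsum_mono[OF abs sum_bnd bnd])
      also have "\<dots> = norm x * (\<Sum>\<^sub>\<infinity>k. norm (sqrt_coeff k))"
        unfolding infsum_cmult_left' by (rule mult.commute)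
      finally show ?thesis .
    qed
  qed
  moreover have P_sym: "inner (P x) y = inner x (P y)" for x y
    using has_sum_bounded_linear[OF bounded_linear_inner_left P[of x], of y]
      has_sum_bounded_linear[OF bounded_linear_inner_right P[of y], of x]
    unfolding inner_scaleR_left inner_scaleR_right pow_sym by (rule has_sum_unique)
  moreover have "0 \<le> inner (P x) x" for x
  proof -
    have "0 \<le> (\<Sum>\<^sub>\<infinity>k. sqrt_coeff k) * (norm x)\<^sup>2"
      by (simp add: infsum_sqrt_coeff_nonneg)
    also have "\<dots> \<le> inner (P x) x"
    proof (rule has_sum_mono)
      show "((\<lambda>k. sqrt_coeff k * (norm x)\<^sup>2) has_sum (\<Sum>\<^sub>\<infinity>k. sqrt_coeff k) * (norm x)\<^sup>2) UNIV"
        by (rule has_sum_cmult_left[OF has_sum_infsum[OF abs_summable_summable[OF sqrt_coeff_abs_summable]]])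
      show "((\<lambda>k. inner (sqrt_coeff k *\<^sub>R (C ^^ k) x) x) has_sum inner (P x) x) UNIV"
        by (rule has_sum_bounded_linear[OF bounded_linear_inner_left P])
      fix k
      \<comment> \<open>Equality holds for \<open>k = 0\<close>; for \<open>k > 0\<close> the
        coefficient is nonpositive and reverses the Cauchy-Schwarz bound.\<close>
      show "sqrt_coeff k * (norm x)\<^sup>2 \<le> inner (sqrt_coeff k *\<^sub>R (C ^^ k) x) x"
      proof (cases k)
        case (Suc j)
        have "inner ((C ^^ k) x) x \<le> norm ((C ^^ k) x) * norm x"
          by (rule norm_cauchy_schwarz)
        also have "\<dots> \<le> (norm x)\<^sup>2"
          by (simp add: power2_eq_square mult_right_mono pow_norm)
        finally show ?thesis
          using sqrt_coeff_nonpos[of j] Suc by (simp add: mult_left_mono_neg del: funpow.simps)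
      qed (simp add: power2_norm_eq_inner)
    qed
    finally show ?thesis .
  qed
  \<comment> \<open>The bounded operator \<open>C ^^ j\<close> moves inside the series of
    \<open>P x\<close>; after the Cauchy product only the terms \<open>n = 0\<close> and
    \<open>n = 1\<close> survive.\<close>
  moreover have "P (P x) = x - C x" for x
  proof -
    have "P (P x) = (\<Sum>\<^sub>\<infinity>j. \<Sum>\<^sub>\<infinity>k. (sqrt_coeff j * sqrt_coeff k) *\<^sub>R (C ^^ (j + k)) x)"
      unfolding P_def[of "P x"]
    proof (rule infsum_cong)
      fix j
      have "((\<lambda>k. sqrt_coeff j *\<^sub>R (C ^^ j) (sqrt_coeff k *\<^sub>R (C ^^ k) x))
          has_sum sqrt_coeff j *\<^sub>R (C ^^ j) (P x)) UNIV"
        by (intro has_sum_bounded_linear[OF bounded_linear_scaleR_right]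
            has_sum_bounded_linear[OF pow_bl] P)
      then show "sqrt_coeff j *\<^sub>R (C ^^ j) (P x)
          = (\<Sum>\<^sub>\<infinity>k. (sqrt_coeff j * sqrt_coeff k) *\<^sub>R (C ^^ (j + k)) x)"
        by (intro infsumI[symmetric])
          (simp add: funpow_add linear_simps(5)[OF pow_bl])
    qed
    also have "\<dots> = (\<Sum>\<^sub>\<infinity>n. (\<Sum>i\<le>n. sqrt_coeff i * sqrt_coeff (n - i)) *\<^sub>R (C ^^ n) x)"
      by (rule infsum_Cauchy_product[OF sqrt_coeff_abs_summable sqrt_coeff_abs_summable pow_norm])
    also have "\<dots> = (\<Sum>\<^sub>\<infinity>n\<in>{0, 1}. (if n = 0 then 1 else - 1) *\<^sub>R (C ^^ n) x)"
      unfolding sqrt_coeff_convolution by (rule infsum_cong_neutral) auto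
    also have "\<dots> = x - C x"
      by simp
    finally show ?thesis .
  qed
  ultimately show ?thesis
    using positive_opI by blast
qed

text \<open>The square root of \<open>A\<^sup>* A\<close>, rescaled by a bound \<open>K\<close> of \<open>A\<close>: \<open>B = A\<^sup>* A / K\<^sup>2\<close> comes from the Riesz theorem,
  and \<open>C = I - B\<close> is a contraction.\<close>

lemma ex_modulus:
  fixes A :: "'a::chilbert_space \<Rightarrow> 'a"
  assumes A: "bounded_clinear A"
  shows "\<exists>P. positive_op P \<and> (\<forall>x y. inner (P x) y = inner x (P y)) \<and> (\<forall>x. norm (P x) = norm (A x))"
proof -
  interpret A: bounded_linear A
    using A by (rule bounded_clinear_bounded_linear)
  obtain K where K: "K > 0" "\<And>x. norm (A x) \<le> norm x * K"
    using A.pos_bounded by blast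
  have "\<exists>z. \<forall>y. inner z y = inner (A x) (A y) / K\<^sup>2" for x
  proof -
    have "bounded_linear (\<lambda>y. inner (A x) (A y) / K\<^sup>2)"
      by (rule bounded_linear_compose[OF bounded_linear_divide])
        (rule bounded_linear_compose[OF bounded_linear_inner_right A.bounded_linear_axioms])
    from Riesz_on_subspace[OF subspace_UNIV closed_UNIV this] show ?thesis
      by simp
  qed
  then obtain B where B: "\<And>x y. inner (B x) y = inner (A x) (A y) / K\<^sup>2"
    by metis
  define C where "C x = x - B x" for x
  have eqI: "u = v" if "\<And>y. inner u y = inner v y" for u v :: 'a
    using that vector_eq_rdot by blast
  \<comment> \<open>Bounding the outer \<open>A\<close> by \<open>K\<close> gives
    \<open>norm (B x) \<le> norm (A x) / K\<close>, whose right side squares to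
    \<open>inner (B x) x\<close>. This is what makes \<open>C\<close> a contraction.\<close>
  have BB: "(norm (B x))\<^sup>2 \<le> inner (B x) x" for x
  proof -
    have "(norm (B x))\<^sup>2 = inner (A x) (A (B x)) / K\<^sup>2"
      by (simp add: power2_norm_eq_inner B)
    also have "\<dots> \<le> norm (A x) * norm (A (B x)) / K\<^sup>2"
      by (intro divide_right_mono norm_cauchy_schwarz) simp
    also have "\<dots> \<le> norm (A x) * (norm (B x) * K) / K\<^sup>2"
      by (intro divide_right_mono mult_left_mono K) simp_all
    also have "\<dots> = norm (B x) * (norm (A x) / K)"
      using K(1) by (simp add: power2_eq_square)
    finally have "norm (B x) * norm (B x) \<le> norm (B x) * (norm (A x) / K)"
      unfolding power2_eq_square .
    then have "norm (B x) \<le> norm (A x) / K" if "B x \<noteq> 0"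
      by (rule mult_left_le_imp_le) (simp add: that)
    then have "norm (B x) \<le> norm (A x) / K"
      using K(1) by (cases "B x = 0") simp_all
    then have "(norm (B x))\<^sup>2 \<le> (norm (A x) / K)\<^sup>2"
      by (rule power_mono) simp
    then show ?thesis
      by (simp add: B power_divide power2_norm_eq_inner)
  qed
  have C_norm: "norm (C x) \<le> norm x" for x
  proof (rule power2_le_imp_le)
    have "(norm (C x))\<^sup>2 = (norm x)\<^sup>2 - 2 * inner (B x) x + (norm (B x))\<^sup>2"
      unfolding C_def power2_norm_eq_inner inner_diff_left inner_diff_right inner_commute[of x "B x"]
      by simp
    moreover have "0 \<le> inner (B x) x"
      by (simp add: B)
    ultimately show "(norm (C x))\<^sup>2 \<le> (norm x)\<^sup>2"
      using BB[of x] by linarith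
  qed simp
  have "bounded_clinear C"
  proof (rule bounded_clinearI[where K = 1])
    have "B (x + y) = B x + B y" for x y
      by (rule eqI) (simp add: B A.add inner_add_left add_divide_distrib)
    then show "C (x + y) = C x + C y" for x y
      by (simp add: C_def)
    have "B (c *\<^sub>C x) = c *\<^sub>C B x" for c x
    proof (rule eqI)
      fix y
      show "inner (B (c *\<^sub>C x)) y = inner (c *\<^sub>C B x) y"
        using inner_scaleC_right[of "B x" "cnj c" y] inner_scaleC_right[of "A x" "cnj c" "A y"]
        by (simp add: B flip: bounded_clinear_scaleC[OF A])
    qed
    then show "C (c *\<^sub>C x) = c *\<^sub>C C x" for c x
      using linear_simps(2)[OF bounded_linear_scaleC, of c x "B x"] by (simp add: C_def)
  qed (simp add: C_norm)
  moreover have "inner (C x) y = inner x (C y)" for x y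
  proof -
    have "inner (B x) y = inner x (B y)"
      by (metis B inner_commute)
    then show ?thesis
      by (simp add: C_def inner_diff_left inner_diff_right)
  qed
  ultimately obtain P where P: "positive_op P" "\<And>x y. inner (P x) y = inner x (P y)"
    "\<And>x. P (P x) = x - C x"
    using ex_positive_sqrt[of C] C_norm by blast
  \<comment> \<open>Since \<open>P\<close> squares to \<open>I - C = B\<close>, symmetry turns
    \<open>(norm (P x))^2\<close> into \<open>inner (B x) x\<close>. The factor \<open>K\<close> in
    \<open>Q\<close> below then undoes the rescaling.\<close>
  have norm_P: "K * norm (P x) = norm (A x)" for x
  proof -
    have "(norm (P x))\<^sup>2 = inner (B x) x"
      by (simp add: power2_norm_eq_inner P(2,3) C_def inner_commute)
    also have "\<dots> = (norm (A x))\<^sup>2 / K\<^sup>2"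
      by (simp add: B power2_norm_eq_inner)
    finally have "(K * norm (P x))\<^sup>2 = (norm (A x))\<^sup>2"
      using K(1) by (simp add: power_mult_distrib)
    then show ?thesis
      using K(1) by (simp add: power2_eq_iff_nonneg)
  qed
  define Q where "Q x = K *\<^sub>R P x" for x
  have Q_sym: "inner (Q x) y = inner x (Q y)" for x y
    by (simp add: Q_def P(2))
  have Q_norm: "norm (Q x) = norm (A x)" for x
    using K(1) norm_P by (simp add: Q_def)
  have P_lin: "bounded_clinear P"
    using P(1) by (simp add: positive_op_def)
  have "positive_op Q"
  proof (rule positive_opI[OF _ Q_sym])
    show "bounded_clinear Q"
      by (rule bounded_clinearI[OF _ _ ord_eq_le_trans[OF Q_norm K(2)]])
        (simp_all add: Q_def linear_simps(1)[OF bounded_clinear_bounded_linear[OF P_lin]]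
          bounded_clinear_scaleC[OF P_lin] scaleR_add_right scaleC_scaleR)
    show "0 \<le> inner (Q x) x" for x
      using P(1) K(1) by (simp add: Q_def positive_op_def complex_nonneg_Reals_iff inner_eq_Re_cinner[of "P x"])
  qed
  then show ?thesis
    using Q_sym Q_norm by blast
qed

section \<open>Unitary operators and polar decomposition\<close>

lemma unitary_op_bounded_clinear: "unitary_op U \<Longrightarrow> bounded_clinear U"
  by (simp add: unitary_op_def)

lemma unitary_op_bij: "unitary_op U \<Longrightarrow> bij U"
  unfolding unitary_op_def using o_bij by blast

lemma unitary_op_norm:
  assumes "unitary_op U"
  shows "norm (U x) = norm x"
proof -
  obtain V where "adjoint_pair U V" "V \<circ> U = id"
    using assms by (auto simp: unitary_op_def)
  then have "cinner (U x) (U x) = cinner x x"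
    by (simp add: adjoint_pair_def pointfree_idE)
  then have "(norm (U x))\<^sup>2 = (norm x)\<^sup>2"
    by (simp only: cinner_self of_real_eq_iff)
  then show ?thesis
    by (simp add: power2_eq_iff_nonneg)
qed

text \<open>Polarisation handles the real inner product, and multiplication by \<open>\<i>\<close>
  transfers this to the imaginary part.\<close>

lemma cinner_eq_of_norm_eq:
  assumes U: "bounded_clinear U" and norm: "\<And>x. norm (U x) = norm x"
  shows "cinner (U x) (U y) = cinner x y"
proof -
  have "inner (U x) (U y) = inner x y" for x y
    by (simp add: dot_norm norm flip: linear_simps(1)[OF bounded_clinear_bounded_linear[OF U]])
  then show ?thesis
    by (simp add: complex_eq_iff Im_cinner flip: inner_eq_Re_cinner bounded_clinear_scaleC[OF U])
qed

text \<open>Preservation of norms gives injectivity, and preservation of inner products makes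
  \<open>inv U\<close> the adjoint.\<close>

lemma unitary_opI:
  assumes U: "bounded_clinear U" and norm: "\<And>x. norm (U x) = norm x" and surj: "surj U"
  shows "unitary_op U"
proof -
  note bl = bounded_clinear_bounded_linear[OF U]
  have "inj U"
    by (rule injI) (metis norm norm_eq_zero right_minus_eq linear_simps(2)[OF bl])
  then have inv: "inv U (U x) = x" "U (inv U x) = x" for x
    using surj by (simp_all add: surj_f_inv_f)
  have "bounded_clinear (inv U)"
  proof (rule bounded_clinearI[where K = 1])
    show "inv U (x + y) = inv U x + inv U y" for x y
      by (metis inv linear_simps(1)[OF bl])
    show "inv U (c *\<^sub>C x) = c *\<^sub>C inv U x" for c x
      by (metis inv bounded_clinear_scaleC[OF U])
    show "norm (inv U x) \<le> norm x * 1" for x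
      by (metis inv(2) norm mult_1_right order_refl)
  qed
  moreover have "adjoint_pair U (inv U)"
    unfolding adjoint_pair_def by (metis cinner_eq_of_norm_eq[OF U norm] inv(2))
  ultimately show ?thesis
    unfolding unitary_op_def using U inv by (intro conjI exI[of _ "inv U"]) auto
qed

lemma unitary_op_inv:
  assumes "unitary_op U"
  shows "unitary_op (inv U)"
proof -
  obtain V where V: "bounded_clinear V" "V \<circ> U = id" "U \<circ> V = id"
    using assms by (auto simp: unitary_op_def)
  then have "inv U = V"
    by (intro inv_unique_comp)
  moreover have "unitary_op V"
  proof (rule unitary_opI[OF V(1)])
    show "norm (V x) = norm x" for x
      using unitary_op_norm[OF assms, of "V x"] V(3) by (simp add: pointfree_idE)
    show "surj V"
      using V(2) by (metis comp_apply id_apply surjI)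
  qed
  ultimately show ?thesis by simp
qed

lemma unitary_op_inv_eq: "inv U (U x) = x" "U (inv U x) = x" if "unitary_op U"
  using unitary_op_bij[OF that] by (simp_all add: bij_is_inj bij_is_surj surj_f_inv_f)

text \<open>As \<open>inv U\<close> is the adjoint of \<open>U\<close>, the quadratic form of the
  conjugate at \<open>x\<close> is that of \<open>A\<close> at \<open>U x\<close>.\<close>

lemma positive_op_conjugate:
  assumes "positive_op A" "unitary_op U"
  shows "positive_op (inv U \<circ> A \<circ> U)"
proof -
  have "cinner (inv U (A (U x))) x = cinner (A (U x)) (U x)" for x
    using cinner_eq_of_norm_eq[OF unitary_op_bounded_clinear unitary_op_norm, OF assms(2,2),
        of "inv U (A (U x))" x] by (simp add: unitary_op_inv_eq[OF assms(2)])
  then show ?thesis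
    using assms unitary_op_inv[OF assms(2)]
    by (simp add: positive_op_def bounded_clinear_compose unitary_op_bounded_clinear)
qed

lemma quasi_invertible_compose_unitary:
  assumes A: "quasi_invertible A" and U: "unitary_op U"
  shows "quasi_invertible (A \<circ> U)"
proof -
  have "range (A \<circ> U) = range A"
    using unitary_op_bij[OF U] by (metis bij_is_surj image_comp)
  then show ?thesis
    using A U unitary_op_bij[OF U]
    by (simp add: quasi_invertible_def bounded_clinear_compose unitary_op_bounded_clinear
        inj_compose bij_is_inj)
qed

lemma unitary_compose_quasi_invertible:
  assumes A: "quasi_invertible A" and U: "unitary_op U"
  shows "quasi_invertible (U \<circ> A)"
proof -
  have "U ` closure (range A) \<subseteq> closure (U ` range A)"
    by (rule closure_bounded_linear_image_subset)
      (rule bounded_clinear_bounded_linear[OF unitary_op_bounded_clinear[OF U]])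
  then have "closure (range (U \<circ> A)) = UNIV"
    using A bij_is_surj[OF unitary_op_bij[OF U]] by (simp add: quasi_invertible_def image_comp top_unique)
  then show ?thesis
    using A U unitary_op_bij[OF U]
    by (simp add: quasi_invertible_def bounded_clinear_compose unitary_op_bounded_clinear
        inj_compose bij_is_inj)
qed

text \<open>Equal norms make \<open>A x \<mapsto> P x\<close> an isometry from
  \<open>range A\<close> onto \<open>range P\<close>; it extends by uniform continuity to the
  closure, which is the whole space.\<close>

lemma unitary_between_dense_ranges:
  fixes A P :: "'a::chilbert_space \<Rightarrow> 'a"
  assumes A: "bounded_clinear A" "inj A" "closure (range A) = UNIV"
    and P: "bounded_clinear P" "closure (range P) = UNIV"
    and norm: "\<And>x. norm (P x) = norm (A x)"
  obtains U where "unitary_op U" "U \<circ> A = P"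
proof -
  interpret A: bounded_linear A by (rule bounded_clinear_bounded_linear[OF A(1)])
  interpret P: bounded_linear P by (rule bounded_clinear_bounded_linear[OF P(1)])
  have "dist (P (inv A u)) (P (inv A v)) = dist u v" if "u \<in> range A" "v \<in> range A" for u v
    using that norm by (simp add: dist_norm f_inv_into_f flip: P.diff A.diff) (simp add: A.diff f_inv_into_f)
  then have "uniformly_continuous_on (range A) (\<lambda>u. P (inv A u))"
    unfolding uniformly_continuous_on_def by auto
  then obtain g where g: "uniformly_continuous_on UNIV g" "\<And>u. u \<in> range A \<Longrightarrow> P (inv A u) = g u"
    using uniformly_continuous_on_extension_on_closure[of "range A"] A(3) by metis
  have gA: "g (A x) = P x" for x
    using g(2)[of "A x"] A(2) by simp
  have g_cont: "(\<lambda>n. g (f n)) \<longlonglongrightarrow> g y" if "f \<longlonglongrightarrow> y" for f y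
    using uniformly_continuous_imp_continuous[OF g(1)] that
    by (auto simp: continuous_on_sequentially comp_def)
  \<comment> \<open>Approximating sequences of this form let norm preservation and linearity pass to
    the limit.\<close>
  have approx: "\<exists>s. (\<lambda>n. A (s n)) \<longlonglongrightarrow> y \<and> (\<lambda>n. P (s n)) \<longlonglongrightarrow> g y" for y
  proof -
    obtain f where f: "\<And>n. f n \<in> range A" "f \<longlonglongrightarrow> y"
      using A(3) closure_sequential[of y "range A"] by auto
    have "A (inv A (f n)) = f n" for n
      using f(1) by (rule f_inv_into_f)
    then show ?thesis
      using f(2) g_cont[OF f(2)] g(2)[OF f(1)] by (intro exI[of _ "\<lambda>n. inv A (f n)"]) simp
  qed
  have g_norm: "norm (g y) = norm y" for y
  proof -
    obtain s where "(\<lambda>n. A (s n)) \<longlonglongrightarrow> y" "(\<lambda>n. P (s n)) \<longlonglongrightarrow> g y"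
      using approx by blast
    then have "(\<lambda>n. norm (A (s n))) \<longlonglongrightarrow> norm y" "(\<lambda>n. norm (A (s n))) \<longlonglongrightarrow> norm (g y)"
      by (auto dest: tendsto_norm simp: norm)
    then show ?thesis
      using LIMSEQ_unique by blast
  qed
  have g_lin: "bounded_clinear g"
  proof (rule bounded_clinearI[where K = 1])
    fix x y
    obtain s t where s: "(\<lambda>n. A (s n)) \<longlonglongrightarrow> x" "(\<lambda>n. P (s n)) \<longlonglongrightarrow> g x"
      and t: "(\<lambda>n. A (t n)) \<longlonglongrightarrow> y" "(\<lambda>n. P (t n)) \<longlonglongrightarrow> g y"
      using approx by metis
    have "(\<lambda>n. g (A (s n + t n))) \<longlonglongrightarrow> g (x + y)"
      unfolding A.add by (intro g_cont tendsto_add s t)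
    moreover have "(\<lambda>n. g (A (s n + t n))) \<longlonglongrightarrow> g x + g y"
      unfolding gA P.add by (intro tendsto_add s t)
    ultimately show "g (x + y) = g x + g y"
      by (rule LIMSEQ_unique)
  next
    fix c x
    obtain s where s: "(\<lambda>n. A (s n)) \<longlonglongrightarrow> x" "(\<lambda>n. P (s n)) \<longlonglongrightarrow> g x"
      using approx by metis
    have "(\<lambda>n. g (A (c *\<^sub>C s n))) \<longlonglongrightarrow> g (c *\<^sub>C x)"
      unfolding bounded_clinear_scaleC[OF A(1)]
      by (intro g_cont bounded_linear.tendsto[OF bounded_linear_scaleC] s)
    moreover have "(\<lambda>n. g (A (c *\<^sub>C s n))) \<longlonglongrightarrow> c *\<^sub>C g x"
      unfolding gA bounded_clinear_scaleC[OF P(1)]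
      by (intro bounded_linear.tendsto[OF bounded_linear_scaleC] s)
    ultimately show "g (c *\<^sub>C x) = c *\<^sub>C g x"
      by (rule LIMSEQ_unique)
  qed (simp add: g_norm)
  \<comment> \<open>An isometric image of a complete space is closed; containing the dense
    \<open>range P\<close>, it is everything.\<close>
  have "complete (range g)"
    by (rule complete_isometric_image[of 1])
      (simp_all add: g_norm bounded_clinear_bounded_linear[OF g_lin] complete_UNIV)
  then have "closure (range P) \<subseteq> range g"
    by (intro closure_minimal complete_imp_closed) (auto simp flip: gA)
  then have "unitary_op g"
    using P(2) by (intro unitary_opI g_lin g_norm) auto
  then show ?thesis
    using gA that by (auto simp: comp_def)
qed

text \<open>The modulus \<open>P\<close> has dense range: by symmetry a vector orthogonal to its
  range lies in its kernel, which is the kernel of the injective \<open>A\<close> because the norms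
  agree.\<close>

lemma polar_decomposition:
  fixes A :: "'a::chilbert_space \<Rightarrow> 'a"
  assumes A: "quasi_invertible A"
  obtains U where "unitary_op U" "positive_op (U \<circ> A)"
proof -
  have A': "bounded_clinear A" "inj A" "closure (range A) = UNIV"
    using A by (auto simp: quasi_invertible_def)
  obtain P where P: "positive_op P" "\<And>x y. inner (P x) y = inner x (P y)" "\<And>x. norm (P x) = norm (A x)"
    using ex_modulus[OF A'(1)] by blast
  have P_lin: "bounded_clinear P"
    using P(1) by (simp add: positive_op_def)
  have "closure (range P) = UNIV"
  proof (rule dense_subspace)
    show "subspace (range P)"
      using bounded_linear.linear[OF bounded_clinear_bounded_linear[OF P_lin]]
      by (rule linear_subspace_image) simp
    fix x assume "\<And>y. y \<in> range P \<Longrightarrow> inner x y = 0"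
    then have "inner (P x) (P x) = 0"
      by (simp add: P(2))
    then have "norm (A x) = 0"
      by (simp flip: P(3))
    then have "A x = A 0"
      by (simp add: linear_simps(3)[OF bounded_clinear_bounded_linear[OF A'(1)]])
    with A'(2) show "x = 0"
      by (rule injD)
  qed
  from unitary_between_dense_ranges[OF A' P_lin this P(3)] obtain U
    where "unitary_op U" "U \<circ> A = P" .
  with P(1) that show ?thesis by simp
qed

lemma ex_unitary_left_step:
  fixes A :: "'a::chilbert_space \<Rightarrow> 'a"
  assumes "quasi_invertible A" "unitary_op W"
  shows "\<exists>U. unitary_op U \<and> positive_op (U \<circ> A \<circ> inv W)"
  using polar_decomposition[OF quasi_invertible_compose_unitary[OF assms(1) unitary_op_inv[OF assms(2)]]]
  by (metis comp_assoc)

text \<open>If \<open>V B\<close> is positive with \<open>V\<close> unitary, so is its conjugate \<open>B V = inv V (V B) V\<close>.\<close>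

lemma ex_unitary_right_step:
  fixes A :: "'a::chilbert_space \<Rightarrow> 'a"
  assumes "quasi_invertible A" "unitary_op U"
  shows "\<exists>W. unitary_op W \<and> positive_op (U \<circ> A \<circ> inv W)"
proof -
  obtain V where V: "unitary_op V" "positive_op (V \<circ> (U \<circ> A))"
    using polar_decomposition[OF unitary_compose_quasi_invertible[OF assms]] .
  \<comment> \<open>The witness for \<open>W\<close> is \<open>inv V\<close>.\<close>
  have "inv V \<circ> (V \<circ> (U \<circ> A)) \<circ> V = U \<circ> A \<circ> inv (inv V)"
    using unitary_op_bij[OF V(1)] by (simp add: fun_eq_iff unitary_op_inv_eq[OF V(1)] inv_inv_eq)
  then show ?thesis
    using positive_op_conjugate[OF V(2,1)] unitary_op_inv[OF V(1)] by metis
qed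

section \<open>Two-sided shifts\<close>

lemma two_sided_dependent_choice:
  fixes R :: "int \<Rightarrow> 'a \<Rightarrow> 'a \<Rightarrow> bool"
  assumes start: "P a"
    and succ: "\<And>n x. P x \<Longrightarrow> \<exists>y. P y \<and> R n x y"
    and pred: "\<And>n y. P y \<Longrightarrow> \<exists>x. P x \<and> R n x y"
  shows "\<exists>f. \<forall>n. P (f n) \<and> R n (f (n - 1)) (f n)"
proof -
  have "\<forall>n x. \<exists>y. P x \<longrightarrow> P y \<and> R n x y" "\<forall>n y. \<exists>x. P y \<longrightarrow> P x \<and> R n x y"
    using succ pred by blast+
  then obtain s p where s: "\<And>n x. P x \<Longrightarrow> P (s n x) \<and> R n x (s n x)"
    and p: "\<And>n y. P y \<Longrightarrow> P (p n y) \<and> R n (p n y) y"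
    by metis
  \<comment> \<open>\<open>F\<close> runs to the right from index 0 and \<open>G\<close> to the
    left. As \<open>R n\<close> links \<open>n - 1\<close> with \<open>n\<close>, the step from
    \<open>k\<close> to \<open>k + 1\<close> uses index \<open>k + 1\<close>, while the step from
    \<open>-k\<close> to \<open>-k - 1\<close> uses \<open>-k\<close>.\<close>
  define F where "F = rec_nat a (\<lambda>k. s (int k + 1))"
  define G where "G = rec_nat a (\<lambda>k. p (- int k))"
  have PF: "P (F k)" and PG: "P (G k)" for k
    by (induction k) (simp_all add: F_def G_def start s p)
  have RF: "R (int k + 1) (F k) (F (Suc k))" and RG: "R (- int k) (G (Suc k)) (G k)" for k
    using s[OF PF[of k]] p[OF PG[of k]] by (simp_all add: F_def G_def)
  define f where "f n = (if 0 \<le> n then F (nat n) else G (nat (- n)))" for n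
  have "P (f n) \<and> R n (f (n - 1)) (f n)" for n
  proof (cases "0 < n")
    case True
    then obtain k where n: "n = int k + 1"
      by (metis add.commute zless_iff_Suc_zadd add_0 of_nat_Suc)
    then show ?thesis
      using RF[of k] PF[of "Suc k"] by (simp add: f_def nat_add_distrib)
  next
    case False
    then obtain k where n: "n = - int k"
      by (metis add.inverse_inverse nonpos_int_cases not_less)
    \<comment> \<open>The index 0 falls in this case, although \<open>f 0\<close> is defined through
      \<open>F\<close>.\<close>
    have "F 0 = G 0"
      by (simp add: F_def G_def)
    then have "f n = G k"
      by (cases "k = 0") (simp_all add: f_def n)
    moreover have "f (n - 1) = G (Suc k)"
      by (simp add: f_def n nat_add_distrib)
    ultimately show ?thesis
      using RG[of k] PG[of k] n by simp
  qed
  then show ?thesis by blast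
qed

text \<open>Meaningful only if the new sequence is square summable; unitary \<open>U n\<close>
  ensure this by preserving norms.\<close>

definition direct_sum_op :: "(int \<Rightarrow> 'a::complex_inner \<Rightarrow> 'a) \<Rightarrow> 'a ell2Z \<Rightarrow> 'a ell2Z" where
  "direct_sum_op U x = Abs_ell2Z (\<lambda>n. U n (nth_ell2Z x n))"

lemma nth_direct_sum_op:
  assumes "\<And>n. unitary_op (U n)"
  shows "nth_ell2Z (direct_sum_op U x) n = U n (nth_ell2Z x n)"
  by (simp add: direct_sum_op_def Abs_ell2Z_inverse nth_ell2Z_summable unitary_op_norm[OF assms])

lemma unitary_direct_sum_op:
  assumes U: "\<And>n. unitary_op (U n)"
  shows "unitary_op (direct_sum_op U)"
proof (rule unitary_opI)
  note nth = nth_direct_sum_op[of U, OF U]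
  note lin = unitary_op_bounded_clinear[OF U]
  show norm: "norm (direct_sum_op U x) = norm x" for x
    by (rule power2_eq_imp_eq) (simp_all add: norm_ell2Z_square nth unitary_op_norm[OF U])
  show "bounded_clinear (direct_sum_op U)"
    by (rule bounded_clinearI[where K = 1])
      (auto intro!: ell2Z_eqI simp: norm nth linear_simps(1)[OF bounded_clinear_bounded_linear[OF lin]]
        bounded_clinear_scaleC[OF lin])
  have "direct_sum_op U (direct_sum_op (\<lambda>n. inv (U n)) y) = y" for y
    by (rule ell2Z_eqI)
      (simp add: nth nth_direct_sum_op unitary_op_inv[OF U] unitary_op_inv_eq[OF U])
  then show "surj (direct_sum_op U)"
    by (rule surjI)
qed

theorem theorem2p5:
  fixes S :: "'h::chilbert_space ell2Z \<Rightarrow> 'h ell2Z"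
    and S_wt :: "int \<Rightarrow> 'h \<Rightarrow> 'h"
  assumes "(UNIV :: 'h set) \<noteq> {0}"
    and "bilateral_weighted_shift S S_wt"
    and "\<And>n. quasi_invertible (S_wt n)"
  shows "\<exists>(T :: 'h ell2Z \<Rightarrow> 'h ell2Z) (T_wt :: int \<Rightarrow> 'h \<Rightarrow> 'h).
           bilateral_weighted_shift T T_wt \<and>
           (\<forall>n. positive_op (T_wt n)) \<and>
           unitarily_equivalent S T"
proof -
  have S: "bounded_clinear (S_wt n)" "S_wt n \<noteq> (\<lambda>_. 0)" "bdd_above (range (\<lambda>n. onorm (S_wt n)))"
    "bounded_clinear S" "nth_ell2Z (S x) n = S_wt n (nth_ell2Z x (n - 1))" for n x
    using assms(2) by (auto simp: bilateral_weighted_shift_def)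
  have "unitary_op (id :: 'h \<Rightarrow> 'h)"
    by (rule unitary_opI) (auto intro: bounded_clinearI[where K = 1])
  from two_sided_dependent_choice[of unitary_op, OF this, of "\<lambda>n W U. positive_op (U \<circ> S_wt n \<circ> inv W)"]
  obtain U where U: "\<And>n. unitary_op (U n)" "\<And>n. positive_op (U n \<circ> S_wt n \<circ> inv (U (n - 1)))"
    using ex_unitary_left_step[OF assms(3)] ex_unitary_right_step[OF assms(3)] by blast
  define T_wt where "T_wt n = U n \<circ> S_wt n \<circ> inv (U (n - 1))" for n
  define D where "D = direct_sum_op U"
  \<comment> \<open>Conjugation by \<open>D\<close> makes the equivalence immediate; it remains to
    recognise \<open>T\<close> as the shift with weights \<open>T_wt\<close>.\<close>
  define T where "T = D \<circ> S \<circ> inv D"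
  have D: "unitary_op D"
    unfolding D_def by (rule unitary_direct_sum_op[OF U(1)])
  note D_inv = unitary_op_inv_eq[OF D]
  note U_inv = unitary_op_inv_eq[OF U(1)]
  have nth_D: "nth_ell2Z (D x) n = U n (nth_ell2Z x n)" for x n
    unfolding D_def by (rule nth_direct_sum_op[OF U(1)])
  have nth_inv_D: "nth_ell2Z (inv D x) n = inv (U n) (nth_ell2Z x n)" for x n
    using nth_D[of "inv D x" n] by (simp add: D_inv U_inv)
  have "bilateral_weighted_shift T T_wt"
    unfolding bilateral_weighted_shift_def
  proof (intro conjI allI)
    fix n
    show "bounded_clinear (T_wt n)"
      using U(2)[of n] by (simp add: T_wt_def positive_op_def)
    show "T_wt n \<noteq> (\<lambda>_. 0)"
    proof
      assume zero: "T_wt n = (\<lambda>_. 0)"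
      \<comment> \<open>Evaluating at \<open>U (n - 1) x\<close> cancels the inner inverse, and the
        isometry \<open>U n\<close> preserves the norm.\<close>
      have "S_wt n x = 0" for x
        using fun_cong[OF zero, of "U (n - 1) x"] unitary_op_norm[OF U(1), of n "S_wt n x"]
        by (simp add: T_wt_def U_inv)
      with S(2)[of n] show False by blast
    qed
  next
    obtain M where M: "\<And>n. onorm (S_wt n) \<le> M"
      using S(3) by (auto simp: bdd_above_def)
    have "onorm (T_wt n) \<le> M" for n
    proof (rule onorm_bound)
      show "0 \<le> M"
        using onorm_pos_le[OF bounded_clinear_bounded_linear[OF S(1)]] M by (rule order_trans)
      fix x
      have "norm (T_wt n x) = norm (S_wt n (inv (U (n - 1)) x))"
        by (simp add: T_wt_def unitary_op_norm[OF U(1)])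
      also have "\<dots> \<le> onorm (S_wt n) * norm (inv (U (n - 1)) x)"
        by (rule onorm[OF bounded_clinear_bounded_linear[OF S(1)]])
      also have "\<dots> \<le> M * norm x"
        by (simp add: unitary_op_norm[OF unitary_op_inv[OF U(1)]] M mult_right_mono)
      finally show "norm (T_wt n x) \<le> M * norm x" .
    qed
    then show "bdd_above (range (\<lambda>n. onorm (T_wt n)))"
      by (rule bdd_aboveI2)
    show "bounded_clinear T"
      unfolding T_def
      by (intro bounded_clinear_compose unitary_op_bounded_clinear unitary_op_inv D S(4))
    fix x n
    show "nth_ell2Z (T x) n = T_wt n (nth_ell2Z x (n - 1))"
      by (simp add: T_def T_wt_def nth_D nth_inv_D S(5))
  qed
  moreover have "unitarily_equivalent S T"
    unfolding unitarily_equivalent_def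
    by (intro exI[of _ D] conjI D) (simp add: T_def fun_eq_iff D_inv)
  ultimately show ?thesis
    using U(2) unfolding T_wt_def by blast
qed

end
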